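(* Let $t\geq 3$ be an integer and let $n\ge 1$. Every edge-colored complete balanced bipartite graph $K^c_{n,n}$ with $\delta^c(K^c_{n,n})\geq \frac{2n}{3}+t$ contains a properly colored 2-factor $H$ such that every cycle of $H$ has length at least $t$.
   Context: $K^c_{n,n}$ denotes the complete bipartite graph $K_{n,n}$ together with an arbitrary assignment of a color to each edge. A subgraph is properly colored (PC) if every two adjacent edges of it have distinct colors. The color degree $d^c(v)$ of a vertex $v$ is the number of distinct colors on the edges incident to $v$, and $\delta^c(K^c_{n,n})=\min_v d^c(v)$. A 2-factor is a spanning 2-regular subgraph (a vertex-disjoint union of cycles covering all vertices). *)

theory Defs
  imports Complex_Main
begin

text \<open>Simple graphs are given by a vertex set and a set of two-element vertex sets; an edge
  colouring is a function on edges, of which only the values on the edge set matter.\<close>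

definition complete_bipartite :: "'v set \<Rightarrow> 'v set \<Rightarrow> 'v set set" where
  "complete_bipartite A B = {{a, b} | a b. a \<in> A \<and> b \<in> B}"

definition incident_edges :: "'v set set \<Rightarrow> 'v \<Rightarrow> 'v set set" where
  "incident_edges E v = {e \<in> E. v \<in> e}"

definition degree :: "'v set set \<Rightarrow> 'v \<Rightarrow> nat" where
  "degree E v = card (incident_edges E v)"

definition color_degree :: "('v set \<Rightarrow> 'c) \<Rightarrow> 'v set set \<Rightarrow> 'v \<Rightarrow> nat" where
  "color_degree c E v = card (c ` incident_edges E v)"

definition min_color_degree :: "('v set \<Rightarrow> 'c) \<Rightarrow> 'v set \<Rightarrow> 'v set set \<Rightarrow> nat" where
  "min_color_degree c V E = Min (color_degree c E ` V)"

definition properly_colored :: "('v set \<Rightarrow> 'c) \<Rightarrow> 'v set set \<Rightarrow> bool" where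
  "properly_colored c F \<longleftrightarrow>
     (\<forall>e\<in>F. \<forall>f\<in>F. e \<noteq> f \<and> e \<inter> f \<noteq> {} \<longrightarrow> c e \<noteq> c f)"

text \<open>A spanning subgraph is identified with its edge set.\<close>

definition two_factor :: "'v set \<Rightarrow> 'v set set \<Rightarrow> 'v set set \<Rightarrow> bool" where
  "two_factor V E F \<longleftrightarrow> F \<subseteq> E \<and> (\<forall>v\<in>V. degree F v = 2)"

text \<open>A cycle is the cyclic list of its distinct vertices, so its length is the length of the
  list. In a 2-regular graph the cycles are exactly the connected components.\<close>

definition is_cycle :: "'v set set \<Rightarrow> 'v list \<Rightarrow> bool" where
  "is_cycle F vs \<longleftrightarrow> 3 \<le> length vs \<and> distinct vs \<and>
     (\<forall>i<length vs. {vs ! i, vs ! (Suc i mod length vs)} \<in> F)"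

end

theory Submission imports Defs begin

text \<open>
  Let \<open>F\<close> be a properly coloured subgraph of maximum degree at most 2, without cycles shorter
  than \<open>t\<close>, having as many edges as possible. If \<open>F\<close> is not a 2-factor, there are \<open>x \<in> A\<close> and
  \<open>y \<in> B\<close> of degree at most 1. Let \<open>m\<close> bound the monochromatic degrees, so that \<open>3m \<le> n - 3t + 3\<close>,
  and let \<open>r\<close> be the number of even integers in \<open>[4, t)\<close>: adding an edge at a vertex of degree at
  most 1 closes a short cycle for at most \<open>r\<close> choices of the other end.

  For almost \<open>n - m\<close> vertices \<open>w \<in> B\<close> one can rotate: replace an edge \<open>ww'\<close> of \<open>F\<close> by \<open>xw\<close>, which
  makes \<open>w'\<close> the new vertex of low degree. Let \<open>S\<close> be the set of the vertices \<open>w'\<close> obtained this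
  way and \<open>p\<close> its size. Symmetrically \<open>y\<close> can replace some edge \<open>zz'\<close> of \<open>F\<close> by \<open>yz'\<close> for almost
  \<open>n - m\<close> vertices \<open>z' \<in> A\<close>. If some \<open>w' \<in> S\<close> could, after its rotation, replace by \<open>w'z\<close> an edge
  \<open>zz'\<close> that \<open>y\<close> can replace too, doing both would enlarge \<open>F\<close>. Hence, for \<open>z \<in> B\<close> with exactly
  \<open>i\<close> incident edges of \<open>F\<close> that \<open>y\<close> cannot replace, the number of \<open>w' \<in> S\<close> that can be
  joined to \<open>z\<close> is \<open>0\<close> for \<open>i = 0\<close>, and at most \<open>m\<close> for \<open>i = 1\<close>, since then all edges \<open>w'z\<close> have
  one colour; for \<open>i = 2\<close> it is at most \<open>p\<close>. These \<open>i\<close> add up to at most about \<open>n + m\<close>. On the other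
  hand every \<open>w' \<in> S\<close> can be joined to about \<open>n - m\<close> vertices \<open>z\<close>, and to almost all \<open>z\<close> if either
  of its two edges can be the one replaced, because the forbidden colours of the two rotations
  differ. Double counting the pairs \<open>(w', z)\<close> gives a contradiction.
\<close>

section \<open>Paths, cycles and the insertion of an edge\<close>

definition nbrs :: "'v set set \<Rightarrow> 'v \<Rightarrow> 'v set" where
  "nbrs F v = {u. {v, u} \<in> F}"

definition is_path :: "'v set set \<Rightarrow> 'v list \<Rightarrow> bool" where
  "is_path F ps \<longleftrightarrow> ps \<noteq> [] \<and> distinct ps \<and> successively (\<lambda>a b. {a, b} \<in> F) ps"

lemma nbrs_sym: "u \<in> nbrs F v \<longleftrightarrow> v \<in> nbrs F u"
  by (simp add: nbrs_def insert_commute)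

lemma nbrs_mono: "F \<subseteq> G \<Longrightarrow> nbrs F v \<subseteq> nbrs G v"
  by (auto simp: nbrs_def)

lemma nbrs_insert: "nbrs (insert {x, w} F) v =
    nbrs F v \<union> (if v = x then {w} else {}) \<union> (if v = w then {x} else {})"
  by (auto simp: nbrs_def doubleton_eq_iff)

lemma nbrs_remove: "nbrs (F - {{x, w}}) v =
    nbrs F v - (if v = x then {w} else {}) - (if v = w then {x} else {})"
  by (auto simp: nbrs_def doubleton_eq_iff)

lemma is_path_rev: "is_path F ps \<Longrightarrow> is_path F (rev ps)"
  by (simp add: is_path_def insert_commute)

lemma is_path_mono: "is_path F ps \<Longrightarrow> F \<subseteq> G \<Longrightarrow> is_path G ps"
  unfolding is_path_def by (auto elim: successively_mono)

lemma is_path_append: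
  "is_path F (us @ vs) \<Longrightarrow> us \<noteq> [] \<Longrightarrow> is_path F us"
  "is_path F (us @ vs) \<Longrightarrow> vs \<noteq> [] \<Longrightarrow> is_path F vs"
  by (auto simp: is_path_def successively_append_iff)

lemma is_path_snoc:
  "is_path F (us @ [v]) \<longleftrightarrow> us = [] \<or> is_path F us \<and> v \<notin> set us \<and> v \<in> nbrs F (last us)"
  by (auto simp: is_path_def successively_append_iff nbrs_def)

lemma length_ge_3_of_ends:
  assumes "hd ps \<noteq> last ps" "ps \<noteq> []" "ps \<noteq> [hd ps, last ps]"
  shows "3 \<le> length ps"
proof -
  obtain a qs where a: "ps = a # qs" using assms(2) by (cases ps) auto
  moreover obtain b rs where b: "qs = b # rs" using assms a by (cases qs) auto
  moreover have "rs \<noteq> []" using assms a b by auto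
  ultimately show ?thesis by (cases rs) auto
qed

lemma path_closes_to_cycle:
  assumes "is_path F ps" "3 \<le> length ps" "{last ps, hd ps} \<in> F"
  shows "is_cycle F ps"
proof -
  have "{ps ! i, ps ! (Suc i mod length ps)} \<in> F" if i: "i < length ps" for i
  proof (cases "Suc i < length ps")
    case True
    then show ?thesis using assms(1)
      by (auto simp: is_path_def successively_conv_nth)
  next
    case False
    then have "Suc i = length ps" using i by simp
    moreover from this have "i = length ps - 1" by simp
    ultimately show ?thesis using assms by (simp add: is_path_def last_conv_nth hd_conv_nth)
  qed
  then show ?thesis using assms by (auto simp: is_cycle_def is_path_def)
qed

text \<open>A cycle through the new edge is rotated until this edge joins its last vertex to its
  first; the list is then a path of \<open>F\<close>, reversed if it starts at \<open>w\<close>.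
  Short cycles created by an insertion thus become short paths present before it.\<close>

lemma cycle_insert_edge_cases:
  assumes "is_cycle (insert {x, w} F) vs"
  shows "is_cycle F vs \<or>
    (\<exists>ps. is_path F ps \<and> length ps = length vs \<and> hd ps = x \<and> last ps = w)"
proof (cases "\<forall>i<length vs. {vs ! i, vs ! (Suc i mod length vs)} \<in> F")
  case True
  then show ?thesis using assms by (auto simp: is_cycle_def)
next
  case False
  define L where "L = length vs"
  from assms have L3: "3 \<le> L" and dist: "distinct vs"
    and ed: "\<And>i. i < L \<Longrightarrow> {vs ! i, vs ! (Suc i mod L)} \<in> insert {x, w} F"
    by (auto simp: is_cycle_def L_def)
  obtain i where i: "i < L" and e: "{vs ! i, vs ! (Suc i mod L)} = {x, w}"
    using False ed by (auto simp: L_def)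
  define us where "us = rotate (Suc i) vs"
  have len: "length us = L" and dus: "distinct us" by (simp_all add: us_def L_def dist)
  have nth: "us ! j = vs ! ((Suc i + j) mod L)" if "j < L" for j
    using that by (simp add: us_def nth_rotate L_def del: rotate_Suc)
  have ne: "us \<noteq> []" using len L3 by auto
  have h: "hd us = vs ! (Suc i mod L)" using nth[of 0] L3 ne by (simp add: hd_conv_nth)
  have "(Suc i + (L - 1)) mod L = i" using i L3 by simp
  then have l: "last us = vs ! i" using nth[of "L - 1"] L3 ne len by (simp add: last_conv_nth)
  have "{us ! j, us ! Suc j} \<in> F" if j: "Suc j < L" for j
  proof -
    have "Suc ((Suc i + j) mod L) mod L = (Suc i + Suc j) mod L"
      by (simp add: mod_Suc_eq)
    then have "{us ! j, us ! Suc j} \<in> insert {x, w} F"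
      using ed[of "(Suc i + j) mod L"] nth[of j] nth[of "Suc j"] j L3 by simp
    moreover have "{us ! j, us ! Suc j} \<noteq> {us ! 0, us ! (L - 1)}"
      using j L3 dus len by (auto simp: doubleton_eq_iff nth_eq_iff_index_eq)
    moreover have "{us ! 0, us ! (L - 1)} = {x, w}"
      using e h l ne len by (simp add: hd_conv_nth last_conv_nth insert_commute)
    ultimately show ?thesis by auto
  qed
  then have p: "is_path F us"
    using ne dus len by (simp add: is_path_def successively_conv_nth)
  from e h l have "hd us = x \<and> last us = w \<or> hd us = w \<and> last us = x"
    by (auto simp: doubleton_eq_iff)
  then show ?thesis
  proof
    assume "hd us = x \<and> last us = w"
    then show ?thesis using p len L_def by blast
  next
    assume "hd us = w \<and> last us = x"
    then have "is_path F (rev us) \<and> length (rev us) = length vs \<and> hd (rev us) = x \<and> last (rev us) = w"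
      using p len ne by (simp add: is_path_rev L_def hd_rev last_rev)
    then show ?thesis by blast
  qed
qed

lemma path_insert_edge_cases:
  assumes "is_path (insert {x, w} F) ps"
  shows "is_path F ps \<or> (\<exists>us vs. ps = us @ [x, w] @ vs \<or> ps = us @ [w, x] @ vs)"
proof (cases "successively (\<lambda>a b. {a, b} \<in> F) ps")
  case True
  then show ?thesis using assms by (auto simp: is_path_def)
next
  case False
  then obtain i where i: "Suc i < length ps" "{ps ! i, ps ! Suc i} \<notin> F"
    by (auto simp: successively_conv_nth)
  then have "{ps ! i, ps ! Suc i} = {x, w}"
    using assms by (auto simp: is_path_def successively_conv_nth)
  moreover have "ps = take i ps @ [ps ! i, ps ! Suc i] @ drop (Suc (Suc i)) ps"
    using i by (simp add: Cons_nth_drop_Suc)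
  ultimately show ?thesis by (metis doubleton_eq_iff)
qed

lemma path_avoiding_vertex:
  assumes "is_path (insert {x, w} F) ps" "x \<notin> set ps \<or> w \<notin> set ps"
  shows "is_path F ps"
  using path_insert_edge_cases[OF assms(1)] assms(2) by auto

text \<open>There is never a choice: \<open>u\<close> has at most one neighbour, and at each later
  vertex one of the at most two neighbours is the predecessor on the path.\<close>

lemma path_unique:
  assumes deg: "\<And>v. finite (nbrs F v) \<and> card (nbrs F v) \<le> 2"
    and "is_path F ps" "is_path F qs" "length ps = length qs"
    and "hd ps = u" "hd qs = u" "card (nbrs F u) \<le> 1"
  shows "ps = qs"
  using assms(2-6)
proof (induction ps arbitrary: qs rule: rev_induct)
  case Nil
  then show ?case by simp
next
  case (snoc a ps)
  obtain qs' b where qs: "qs = qs' @ [b]" using snoc.prems(3) by (cases qs rule: rev_cases) auto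
  show ?case
  proof (cases "ps = []")
    case True
    then show ?thesis using snoc.prems qs by auto
  next
    case False
    then have ne: "qs' \<noteq> []" using snoc.prems(3) qs by auto
    have eq: "qs' = ps"
      using snoc.IH[of qs'] snoc.prems qs False ne by (auto simp: is_path_snoc)
    have a: "a \<in> nbrs F (last ps)" "a \<notin> set ps" and b: "b \<in> nbrs F (last ps)" "b \<notin> set ps"
      using snoc.prems qs eq False by (auto simp: is_path_snoc)
    have "a = b"
    proof (rule ccontr)
      assume ab: "a \<noteq> b"
      show False
      proof (cases ps rule: rev_cases)
        case Nil
        then show ?thesis using False by simp
      next
        case (snoc ps' l)
        show ?thesis
        proof (cases "ps' = []")
          case True
          then have "last ps = u" using snoc snoc.prems(4) by simp
          then have "{a, b} \<subseteq> nbrs F u" using a b by simp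
          then have "card {a, b} \<le> 1" using deg assms(7) card_mono by (metis order_trans)
          then show ?thesis using ab by simp
        next
          case f: False
          have "is_path F ps" using snoc.prems(1) False by (simp add: is_path_snoc)
          then have "l \<in> nbrs F (last ps')" using snoc f by (simp add: is_path_snoc)
          then have "last ps' \<in> nbrs F (last ps)" using snoc by (simp add: nbrs_sym)
          moreover have "last ps' \<noteq> a" "last ps' \<noteq> b" using a b snoc f by auto
          ultimately have "{last ps', a, b} \<subseteq> nbrs F (last ps)" "card {last ps', a, b} = 3"
            using a b ab by auto
          then show ?thesis using deg[of "last ps"] card_mono[of "nbrs F (last ps)" "{last ps', a, b}"] by simp
        qed
      qed
    qed
    then show ?thesis using eq qs by simp
  qed
qed

text \<open>By \<open>path_unique\<close> the length determines a path starting at \<open>u\<close>,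
  hence its end, so each length in \<open>L\<close> accounts for at most one vertex.\<close>

lemma card_path_ends:
  assumes deg: "\<And>v. finite (nbrs F v) \<and> card (nbrs F v) \<le> 2"
    and u: "card (nbrs F u) \<le> 1" and L: "finite L"
    and sub: "\<And>v. v \<in> V \<Longrightarrow> \<exists>ps. is_path F ps \<and> hd ps = u \<and> last ps = v \<and> length ps \<in> L"
  shows "finite V \<and> card V \<le> card L"
proof -
  obtain p where p: "\<And>v. v \<in> V \<Longrightarrow> is_path F (p v) \<and> hd (p v) = u \<and> last (p v) = v \<and> length (p v) \<in> L"
    using sub by metis
  have "inj_on (\<lambda>v. length (p v)) V"
  proof
    fix v v' assume v: "v \<in> V" "v' \<in> V" "length (p v) = length (p v')"
    then have "p v = p v'" using path_unique[OF deg, of "p v" "p v'" u] p u by auto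
    then show "v = v'" using p v by metis
  qed
  moreover have "(\<lambda>v. length (p v)) ` V \<subseteq> L" using p by auto
  ultimately show ?thesis using L by (meson card_inj_on_le inj_on_finite)
qed

section \<open>Double counting and the final inequality\<close>

lemma sum_card_swap:
  assumes "finite A" "finite B"
  shows "(\<Sum>a\<in>A. card {b \<in> B. P a b}) = (\<Sum>b\<in>B. card {a \<in> A. P a b})"
proof -
  have "(\<Sum>a\<in>A. card {b \<in> B. P a b}) = (\<Sum>a\<in>A. \<Sum>b\<in>B. of_bool (P a b))"
    using assms by (simp add: Int_def)
  also have "\<dots> = (\<Sum>b\<in>B. \<Sum>a\<in>A. of_bool (P a b))" by (rule sum.swap)
  also have "\<dots> = (\<Sum>b\<in>B. card {a \<in> A. P a b})" using assms by (simp add: Int_def)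
  finally show ?thesis .
qed

text \<open>In the application \<open>p\<close> is the size of \<open>S\<close>, \<open>H\<close>
  the number of rotations at \<open>x\<close>, \<open>K\<close> the sum of the numbers
  \<open>i\<close>, and \<open>T\<close> the number of pairs \<open>(w', z)\<close>.
  \<open>T1\<close> and \<open>T2\<close> bound \<open>T\<close> from below, \<open>U1\<close> and
  \<open>U2\<close> from above.\<close>

lemma counting_contradiction:
  fixes n m r p H K T :: int
  assumes n: "3 * m + 6 * r + 6 \<le> n" and r: "0 \<le> r" and m: "0 \<le> m"
    and H: "n \<le> H + m + r + 1" and Hp: "H \<le> 2 * p" and K: "K \<le> n + m + 1"
    and T1: "p * (n - m - 2 * r - 1) \<le> T"
    and T2: "2 * r + 1 \<le> m \<Longrightarrow> p * (n - m - 2 * r - 1) + (H - p) * (m - 2 * r - 1) \<le> T"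
    and U1: "2 * m \<le> p \<Longrightarrow> 2 * T \<le> p * K"
    and U2: "m \<le> p \<Longrightarrow> p \<le> 2 * m \<Longrightarrow> T \<le> (p - m) * K + (2 * m - p) * n"
  shows False
proof (cases "2 * m \<le> p")
  case True
  have p: "0 < p" using n r m H Hp by linarith
  have "2 * (p * (n - m - 2 * r - 1)) \<le> p * (n + m + 1)"
    using T1 U1[OF True] mult_left_mono[OF K, of p] p by linarith
  then have "p * (2 * (n - m - 2 * r - 1)) \<le> p * (n + m + 1)" by (simp add: algebra_simps)
  then have "2 * (n - m - 2 * r - 1) \<le> n + m + 1" using p mult_le_cancel_left_pos by blast
  then show False using n r by simp
next
  case False
  then have p2: "p \<le> 2 * m" by simp
  \<comment> \<open>\<open>H\<close> and \<open>Hp\<close> give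
    \<open>n - m - r - 1 \<le> 2 * p\<close>, which with \<open>n\<close> forces
    \<open>m \<le> p\<close>; as \<open>p < 2 * m\<close>, also \<open>n < 5 * m + r + 1\<close>, so
    \<open>m\<close> is large compared with \<open>r\<close>.\<close>
  have mr: "2 * r + 1 \<le> m" and mp: "m \<le> p" using n r m H Hp False by linarith+
  \<comment> \<open>With the slack \<open>k\<close> as a variable, the last inequality becomes a
    polynomial with nonnegative coefficients and a positive constant term.\<close>
  define k where "k = n - (3 * m + 6 * r + 6)"
  have k: "0 \<le> k" "n = 3 * m + 6 * r + 6 + k" using n by (auto simp: k_def)
  have "(n - m - r - 1 - p) * (m - 2 * r - 1) \<le> (H - p) * (m - 2 * r - 1)"
    using H mr by (intro mult_right_mono) auto
  moreover have "(p - m) * K \<le> (p - m) * (n + m + 1)" using K mp by (intro mult_left_mono) auto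
  ultimately have le: "p * (n - m - 2 * r - 1) + (n - m - r - 1 - p) * (m - 2 * r - 1)
      \<le> (p - m) * (n + m + 1) + (2 * m - p) * n"
    using T2[OF mr] U2[OF mp p2] by linarith
  \<comment> \<open>In \<open>le\<close> the variable \<open>p\<close> occurs linearly; collected on
    the left it has the nonnegative coefficient \<open>n - 3 * m - 1\<close>, so twice
    \<open>p\<close> may be replaced by its lower bound \<open>n - m - r - 1\<close>.\<close>
  have "(n - m - r - 1) * (n - 3 * m - 1) \<le> (2 * p) * (n - 3 * m - 1)"
    using H Hp n r by (intro mult_right_mono) auto
  then have "(n - m - r - 1) * (n - 3 * m - 1) + 2 * m \<le> 2 * ((n - m) * (2 * r + 1)) + 2 * ((r + 1) * (m - 2 * r - 1))"
    using le by (simp add: algebra_simps)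
  then have "k * k + 15 + 6 * m + 2 * (m * k) + 8 * k + 2 * (m * r) + 7 * (r * k) + 25 * r + 10 * (r * r) \<le> 0"
    unfolding k(2) by (simp add: algebra_simps)
  moreover have "0 \<le> m * r" "0 \<le> m * k" "0 \<le> r * k" "0 \<le> r * r" "0 \<le> k * k" using m r k by auto
  ultimately show False using m r k(1) by linarith
qed

section \<open>Good subgraphs and the exchange of edges\<close>

locale coloured_bipartite =
  fixes A B :: "'v set" and c :: "'v set \<Rightarrow> 'c" and n m r t :: nat
  assumes fin: "finite A" "finite B" and disj: "A \<inter> B = {}"
    and card_A: "card A = n" and card_B: "card B = n"
    and mono_A: "\<And>v \<gamma>. v \<in> A \<Longrightarrow> card {u \<in> B. c {v, u} = \<gamma>} \<le> m"
    and mono_B: "\<And>v \<gamma>. v \<in> B \<Longrightarrow> card {u \<in> A. c {v, u} = \<gamma>} \<le> m"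
    and n_ge: "3 * m + 6 * r + 6 \<le> n" and t_le: "t \<le> 2 * r + 4"
begin

abbreviation "E \<equiv> complete_bipartite A B"

definition good :: "'v set set \<Rightarrow> bool" where
  "good F \<longleftrightarrow> F \<subseteq> E \<and> (\<forall>v. card (nbrs F v) \<le> 2) \<and> (\<forall>v. inj_on (\<lambda>u. c {v, u}) (nbrs F v)) \<and>
     (\<forall>vs. is_cycle F vs \<longrightarrow> t \<le> length vs)"

text \<open>Joining \<open>u\<close> to such a vertex would close a cycle shorter than
  \<open>t\<close>, on the same vertices as the path. The bound 3 excludes a single edge, which
  closes to no cycle.\<close>

definition near :: "'v set set \<Rightarrow> 'v \<Rightarrow> 'v set" where
  "near F u = {v. \<exists>ps. is_path F ps \<and> hd ps = u \<and> last ps = v \<and> 3 \<le> length ps \<and> length ps < t}"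

text \<open>Adding \<open>vw\<close> causes no colour conflict at \<open>v\<close>. The case
  \<open>u = w\<close> also excludes that \<open>vw\<close> is already an edge.\<close>

definition free :: "'v set set \<Rightarrow> 'v \<Rightarrow> 'v \<Rightarrow> bool" where
  "free F v w \<longleftrightarrow> (\<forall>u\<in>nbrs F v. c {v, u} \<noteq> c {v, w})"

text \<open>Adding the edge \<open>vw\<close> and deleting \<open>ww'\<close> causes no colour conflict at \<open>w\<close>.\<close>

definition drops :: "'v set set \<Rightarrow> 'v \<Rightarrow> 'v \<Rightarrow> 'v \<Rightarrow> bool" where
  "drops F v w w' \<longleftrightarrow> w' \<in> nbrs F w \<and> (\<forall>u\<in>nbrs F w - {w'}. c {w, u} \<noteq> c {w, v})"

definition rot :: "'v set set \<Rightarrow> 'v \<Rightarrow> 'v \<Rightarrow> 'v \<Rightarrow> 'v set set" where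
  "rot F x w w' = insert {x, w} (F - {{w, w'}})"

lemma E_iff: "{a, b} \<in> E \<longleftrightarrow> a \<in> A \<and> b \<in> B \<or> a \<in> B \<and> b \<in> A"
  by (auto simp: complete_bipartite_def doubleton_eq_iff)

lemma finite_E: "finite E"
proof -
  have "E \<subseteq> (\<lambda>(a, b). {a, b}) ` (A \<times> B)" by (auto simp: complete_bipartite_def)
  then show ?thesis by (rule finite_subset) (use fin in simp)
qed

lemma nbrs_side:
  assumes "F \<subseteq> E"
  shows "v \<in> A \<Longrightarrow> nbrs F v \<subseteq> B" "v \<in> B \<Longrightarrow> nbrs F v \<subseteq> A" "u \<in> nbrs F v \<Longrightarrow> v \<in> A \<union> B"
  using assms disj by (auto simp: nbrs_def E_iff dest!: subsetD)

lemma nbrs_irrefl: "F \<subseteq> E \<Longrightarrow> v \<notin> nbrs F v"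
  using disj E_iff[of v v] by (auto simp: nbrs_def)

lemma finite_nbrs: "F \<subseteq> E \<Longrightarrow> finite (nbrs F v)"
proof -
  assume "F \<subseteq> E"
  then have "nbrs F v \<subseteq> A \<union> B" by (auto simp: nbrs_def E_iff dest!: subsetD)
  then show ?thesis using fin finite_subset by blast
qed

lemma goodD:
  assumes "good F"
  shows "F \<subseteq> E" "finite F" "finite (nbrs F v)" "card (nbrs F v) \<le> 2"
    "inj_on (\<lambda>u. c {v, u}) (nbrs F v)" "is_cycle F vs \<Longrightarrow> t \<le> length vs"
  using assms finite_nbrs finite_subset[OF _ finite_E] unfolding good_def by auto

lemma good_subset: "good F \<Longrightarrow> G \<subseteq> F \<Longrightarrow> good G"
proof -
  assume g: "good F" and s: "G \<subseteq> F"
  have nb: "nbrs G v \<subseteq> nbrs F v" for v using s by (rule nbrs_mono)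
  have "card (nbrs G v) \<le> 2" for v
    using card_mono[OF goodD(3)[OF g] nb[of v]] goodD(4)[OF g, of v] by simp
  moreover have "is_cycle G vs \<Longrightarrow> is_cycle F vs" for vs
    using s by (auto simp: is_cycle_def)
  ultimately show ?thesis using g s nb unfolding good_def by (meson inj_on_subset order_trans)
qed

lemma free_not_nbr: "free F v w \<Longrightarrow> w \<notin> nbrs F v"
  by (auto simp: free_def)

lemma near_mono: "F \<subseteq> G \<Longrightarrow> near F u \<subseteq> near G u"
  unfolding near_def using is_path_mono by blast

lemma near_nbrs_nonempty: "v \<in> near F u \<Longrightarrow> nbrs F v \<noteq> {}"
proof -
  assume "v \<in> near F u"
  then obtain ps where p: "is_path F ps" "last ps = v" "3 \<le> length ps" by (auto simp: near_def)
  define us where "us = butlast ps"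
  have "ps = us @ [v]" using p by (simp add: us_def is_path_def flip: p(2))
  moreover from this have "us \<noteq> []" using p(3) by auto
  ultimately have us: "ps = us @ [v]" "us \<noteq> []" by auto
  then have "v \<in> nbrs F (last us)" using p by (simp add: is_path_snoc)
  then show ?thesis using nbrs_sym by fastforce
qed

text \<open>The path and the edge \<open>uv\<close> form a cycle of \<open>F\<close>; it has at
  least three vertices because the path avoids this edge.\<close>

lemma no_short_detour:
  assumes g: "good F" and e: "{u, v} \<in> F" and q: "is_path (F - {{u, v}}) ps"
    and "hd ps = u" "last ps = v"
  shows "t \<le> length ps"
proof -
  have "u \<noteq> v" using e nbrs_irrefl[OF goodD(1)[OF g]] by (auto simp: nbrs_def)
  moreover have "ps \<noteq> []" "ps \<noteq> [u, v]" using q by (auto simp: is_path_def)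
  ultimately have "3 \<le> length ps"
    using length_ge_3_of_ends[of ps] assms(4,5) by simp
  moreover have "{last ps, hd ps} \<in> F" using assms by (simp add: insert_commute)
  ultimately have "is_cycle F ps"
    using path_closes_to_cycle is_path_mono[OF q, of F] by blast
  then show ?thesis by (rule goodD(6)[OF g])
qed

text \<open>Degrees and colours change only at the two ends, and a short new cycle would leave a
  path putting \<open>w\<close> into \<open>near F x\<close>.\<close>

lemma good_insert:
  assumes g: "good F" and e: "{x, w} \<in> E" and dx: "card (nbrs F x) \<le> 1" and dw: "card (nbrs F w) \<le> 1"
    and fx: "free F x w" and fw: "free F w x" and nn: "w \<notin> near F x"
  shows "good (insert {x, w} F) \<and> card (insert {x, w} F) = card F + 1"
proof -
  have xw: "x \<noteq> w" using e disj by (auto simp: E_iff)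
  have nin: "{x, w} \<notin> F" using free_not_nbr[OF fx] by (auto simp: nbrs_def)
  let ?G = "insert {x, w} F"
  note nb = nbrs_insert[of x w F]
  have nx: "nbrs ?G x = insert w (nbrs F x)" and nw: "nbrs ?G w = insert x (nbrs F w)"
    using xw by (auto simp: nb)
  have no: "nbrs ?G v = nbrs F v" if "v \<noteq> x" "v \<noteq> w" for v using that by (simp add: nb)
  have "card (nbrs ?G v) \<le> 2" for v
    using card_insert_le_m1[of 2] goodD(4)[OF g, of v] dx dw nx nw no[of v]
    by (cases "v = x"; cases "v = w") (auto intro!: card_insert_le_m1)
  moreover have "inj_on (\<lambda>u. c {v, u}) (nbrs ?G v)" for v
    using goodD(5)[OF g, of v] fx fw nx nw no[of v] unfolding free_def
    by (cases "v = x"; cases "v = w") (fastforce simp: inj_on_insert)+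
  moreover have "t \<le> length vs" if "is_cycle ?G vs" for vs
  proof (rule ccontr)
    assume "\<not> t \<le> length vs"
    moreover have "3 \<le> length vs" using that by (simp add: is_cycle_def)
    ultimately show False
      using cycle_insert_edge_cases[OF that] goodD(6)[OF g, of vs] nn
      unfolding near_def by (metis (mono_tags, lifting) mem_Collect_eq not_le)
  qed
  ultimately have "good ?G" using e goodD(1)[OF g] unfolding good_def by auto
  then show ?thesis using nin goodD(2)[OF g] by simp
qed

text \<open>The deletion is made first: it lowers the degree of \<open>w\<close> to at most 1 and
  can only shrink \<open>near\<close>, so \<open>good_insert\<close> applies.\<close>

lemma good_rot:
  assumes g: "good F" and e: "{x, w} \<in> E" and dx: "card (nbrs F x) \<le> 1"
    and fx: "free F x w" and dr: "drops F x w w'" and nn: "w \<notin> near F x"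
  shows "good (rot F x w w') \<and> card (rot F x w w') = card F"
proof -
  let ?G = "F - {{w, w'}}"
  have xw: "x \<noteq> w" using e disj by (auto simp: E_iff)
  have w': "w' \<in> nbrs F w" using dr by (simp add: drops_def)
  have ww': "w \<noteq> w'" using w' nbrs_irrefl goodD(1)[OF g] by metis
  have xw': "x \<noteq> w'" using free_not_nbr[OF fx] w' nbrs_sym by metis
  have gG: "good ?G" using g good_subset by blast
  have nx: "nbrs ?G x = nbrs F x" and nw: "nbrs ?G w = nbrs F w - {w'}"
    using xw xw' ww' by (auto simp: nbrs_remove)
  have "card (nbrs ?G w) \<le> 1" using nw w' goodD(3,4)[OF g, of w] by simp
  moreover have "free ?G w x" using dr unfolding free_def drops_def nw by blast
  moreover have "free ?G x w" using fx unfolding free_def nx .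
  moreover have "w \<notin> near ?G x" using nn near_mono[of ?G F x] by blast
  moreover have "card (nbrs ?G x) \<le> 1" using nx dx by simp
  ultimately have "good (insert {x, w} ?G) \<and> card (insert {x, w} ?G) = card ?G + 1"
    using good_insert[OF gG e] by blast
  moreover have "card ?G + 1 = card F"
    using w' goodD(2)[OF g] card_Suc_Diff1[of F "{w, w'}"] by (simp add: nbrs_def)
  ultimately show ?thesis by (simp add: rot_def)
qed

lemma nbrs_rot:
  assumes "good F" "{x, w} \<in> E" "free F x w" "drops F x w w'"
  shows "nbrs (rot F x w w') x = insert w (nbrs F x)"
    "nbrs (rot F x w w') w = insert x (nbrs F w - {w'})"
    "nbrs (rot F x w w') w' = nbrs F w' - {w}"
    "v \<noteq> x \<Longrightarrow> v \<noteq> w \<Longrightarrow> v \<noteq> w' \<Longrightarrow> nbrs (rot F x w w') v = nbrs F v"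
    "x \<noteq> w'"
proof -
  have xw: "x \<noteq> w" using assms disj by (auto simp: E_iff)
  have w': "w' \<in> nbrs F w" using assms by (simp add: drops_def)
  have ww': "w \<noteq> w'" using w' nbrs_irrefl goodD(1)[OF assms(1)] by metis
  show xw': "x \<noteq> w'" using free_not_nbr[OF assms(3)] w' nbrs_sym by metis
  show "nbrs (rot F x w w') x = insert w (nbrs F x)"
    "nbrs (rot F x w w') w = insert x (nbrs F w - {w'})"
    "nbrs (rot F x w w') w' = nbrs F w' - {w}"
    "v \<noteq> x \<Longrightarrow> v \<noteq> w \<Longrightarrow> v \<noteq> w' \<Longrightarrow> nbrs (rot F x w w') v = nbrs F v"
    using xw xw' ww' by (auto simp: rot_def nbrs_insert nbrs_remove)
qed

text \<open>The edge \<open>ww'\<close> is replaced by both \<open>xw\<close> and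
  \<open>yw'\<close>. After the rotation at \<open>x\<close>, a short path from \<open>y\<close> to
  \<open>w'\<close> has to use \<open>xw\<close>, by \<open>ny\<close>; neither direction is
  possible.\<close>

lemma double_exchange:
  assumes g: "good F" and x: "x \<in> A" and y: "y \<in> B" and w: "w \<in> B"
    and dx: "card (nbrs F x) \<le> 1" and dy: "card (nbrs F y) \<le> 1"
    and fx: "free F x w" and drx: "drops F x w w'" and nx: "w \<notin> near F x"
    and fy: "free F y w'" and dry: "drops F y w' w" and ny: "w' \<notin> near (F - {{w, w'}}) y"
  shows "\<exists>G. good G \<and> card G = card F + 1"
proof -
  let ?G = "F - {{w, w'}}" and ?R = "rot F x w w'"
  have e: "{x, w} \<in> E" using x w by (simp add: E_iff)
  have R: "good ?R" "card ?R = card F" using good_rot[OF g e dx fx drx nx] by auto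
  note nr = nbrs_rot[OF g e fx drx]
  have w': "w' \<in> nbrs F w" using drx by (simp add: drops_def)
  have w'A: "w' \<in> A" using w' w nbrs_side(2)[OF goodD(1)[OF g]] by blast
  have yw: "y \<noteq> w" using free_not_nbr[OF fy] w' by auto
  have yx: "y \<noteq> x" "y \<noteq> w'" using x y w'A disj by auto
  have nry: "nbrs ?R y = nbrs F y" using nr(4) yw yx by simp
  have nrw': "nbrs ?R w' = nbrs F w' - {w}" by (rule nr(3))
  have ey: "{y, w'} \<in> E" using y w'A by (simp add: E_iff)
  have "card (nbrs ?R w') \<le> 1"
    using nrw' w' goodD(3,4)[OF g, of w'] nbrs_sym[of w' F w] by simp
  moreover have "free ?R y w'" using fy nry by (simp add: free_def)
  moreover have "free ?R w' y" using dry nrw' by (auto simp: free_def drops_def)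
  moreover have "w' \<notin> near ?R y"
  proof
    assume "w' \<in> near ?R y"
    then obtain ps where p: "is_path ?R ps" "hd ps = y" "last ps = w'" "3 \<le> length ps" "length ps < t"
      by (auto simp: near_def)
    from p(1) have dps: "distinct ps" by (simp add: is_path_def)
    have "\<not> is_path ?G ps" using p ny by (auto simp: near_def)
    then obtain us vs where "ps = us @ [x, w] @ vs \<or> ps = us @ [w, x] @ vs"
      using path_insert_edge_cases[OF p(1)[unfolded rot_def]] by blast
    then show False
    proof
      \<comment> \<open>From \<open>w\<close> on, the path avoids \<open>xw\<close> and closes with
        \<open>ww'\<close> to a short cycle of \<open>F\<close>.\<close>
      assume ps: "ps = us @ [x, w] @ vs"
      then have "is_path ?R ((us @ [x]) @ (w # vs))" using p(1) by simp
      then have "is_path ?R (w # vs)" by (rule is_path_append(2)) simp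
      then have q: "is_path ?G (w # vs)"
        using path_avoiding_vertex[of x w ?G] dps ps unfolding rot_def by auto
      have "t \<le> length (w # vs)"
        using no_short_detour[OF g _ q] w' p(3) ps by (simp add: nbrs_def)
      then show False using ps p(5) by simp
    next
      \<comment> \<open>From \<open>x\<close> on, the path can be continued by the edge
        \<open>w'w\<close>, which gives a short path of \<open>F\<close> from \<open>x\<close> to
        \<open>w\<close>, against \<open>nx\<close>.\<close>
      assume ps: "ps = us @ [w, x] @ vs"
      then have us: "us \<noteq> []" using p(2) yw by auto
      have "is_path ?R ((us @ [w]) @ (x # vs))" using p(1) ps by simp
      then have "is_path ?R (x # vs)" by (rule is_path_append(2)) simp
      then have q: "is_path ?G (x # vs)"
        using path_avoiding_vertex[of x w ?G] dps ps unfolding rot_def by auto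
      have l: "last (x # vs) = w'" using p(3) ps by simp
      then have "vs \<noteq> []" using nr(5) by auto
      moreover have "is_path F ((x # vs) @ [w])"
        unfolding is_path_snoc using is_path_mono[OF q, of F] dps ps l w' nbrs_sym[of w' F w] by auto
      moreover have "length ((x # vs) @ [w]) < t" using ps us p(5) by (cases us) auto
      ultimately have "w \<in> near F x" unfolding near_def
        by (intro CollectI exI[of _ "(x # vs) @ [w]"]) (auto simp: Suc_le_eq)
      then show False using nx by simp
    qed
  qed
  ultimately obtain G where "good G" "card G = card ?R + 1"
    using good_insert[OF R(1) ey] nry dy by auto
  then show ?thesis using R(2) by auto
qed

section \<open>Counting the vertices excluded by short cycles or by colours\<close>

lemma path_parity:
  assumes "F \<subseteq> E" "is_path F ps" "hd ps \<in> A \<union> B"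
  shows "last ps \<in> A \<union> B \<and> (last ps \<in> A \<longleftrightarrow> (hd ps \<in> A \<longleftrightarrow> odd (length ps)))"
  using assms(2,3)
proof (induction ps rule: rev_induct)
  case Nil
  then show ?case by (simp add: is_path_def)
next
  case (snoc v ps)
  show ?case
  proof (cases "ps = []")
    case True
    then show ?thesis using snoc.prems by simp
  next
    case False
    then have "is_path F ps" "v \<in> nbrs F (last ps)" using snoc.prems by (auto simp: is_path_snoc)
    then show ?thesis
      using snoc.IH snoc.prems(2) False nbrs_side[OF assms(1), of "last ps"] disj by auto
  qed
qed

text \<open>A path from \<open>A\<close> to \<open>B\<close> has an even number of vertices, so by
  \<open>t_le\<close> only the \<open>r\<close> lengths \<open>2 * k + 4\<close> with
  \<open>k < r\<close> can occur.\<close>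

lemma card_near:
  assumes g: "good F" and x: "x \<in> A" and dx: "card (nbrs F x) \<le> 1"
  shows "card (near F x \<inter> B) \<le> r"
proof -
  have "\<exists>ps. is_path F ps \<and> hd ps = x \<and> last ps = v \<and> length ps \<in> (\<lambda>k. 2 * k + 4) ` {..<r}"
    if v: "v \<in> near F x \<inter> B" for v
  proof -
    obtain ps where p: "is_path F ps" "hd ps = x" "last ps = v" "3 \<le> length ps" "length ps < t"
      using v unfolding near_def by blast
    have "even (length ps)"
      using path_parity[OF goodD(1)[OF g] p(1)] p v x disj by auto
    then obtain j where "length ps = 2 * j" by (rule evenE)
    then have "length ps = 2 * (j - 2) + 4" "j - 2 < r" using p(4,5) t_le by linarith+
    then show ?thesis using p by blast
  qed
  then have "card (near F x \<inter> B) \<le> card ((\<lambda>k. 2 * k + 4) ` {..<r})"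
    using card_path_ends[OF _ dx] goodD(3,4)[OF g] by blast
  also have "\<dots> \<le> r" using card_image_le[of "{..<r}"] by simp
  finally show ?thesis .
qed

text \<open>Vertices with an edge \<open>zz'\<close> whose replacement by \<open>yz'\<close> would
  close a short cycle.\<close>

definition blocked :: "'v set set \<Rightarrow> 'v \<Rightarrow> 'v set" where
  "blocked F y = {z \<in> B. \<exists>z'\<in>nbrs F z. z' \<in> near (F - {{z, z'}}) y}"

text \<open>The path from \<open>y\<close> to \<open>z'\<close> misses \<open>z\<close>, since
  otherwise its part from \<open>z\<close> on would close with \<open>zz'\<close> to a short cycle
  of \<open>F\<close>. Appending \<open>z\<close> gives a path of \<open>F\<close> with one of
  \<open>r\<close> odd lengths, which determines \<open>z\<close>.\<close>

lemma card_blocked: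
  assumes g: "good F" and y: "y \<in> B" and dy: "card (nbrs F y) \<le> 1"
  shows "card (blocked F y) \<le> r"
proof -
  have "\<exists>ps. is_path F ps \<and> hd ps = y \<and> last ps = z \<and> length ps \<in> (\<lambda>k. 2 * k + 5) ` {..<r}"
    if bz: "z \<in> blocked F y" for z
  proof -
    obtain z' ps where z: "z \<in> B" "z' \<in> nbrs F z" and p: "is_path (F - {{z, z'}}) ps"
      "hd ps = y" "last ps = z'" "3 \<le> length ps" "length ps < t"
      using bz unfolding blocked_def near_def by blast
    have pF: "is_path F ps" using is_path_mono[OF p(1)] by auto
    have z'A: "z' \<in> A" using z nbrs_side(2)[OF goodD(1)[OF g]] by blast
    have "even (length ps)"
      using path_parity[OF goodD(1)[OF g] pF] p z'A y disj by auto
    then obtain j where "length ps = 2 * j" by (rule evenE)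
    then have len: "length (ps @ [z]) = 2 * (j - 2) + 5" "j - 2 < r"
      using p(4,5) t_le by auto
    have "z \<notin> set ps"
    proof
      assume "z \<in> set ps"
      then obtain us vs where ps: "ps = us @ z # vs" by (meson split_list)
      then have "is_path (F - {{z, z'}}) (z # vs)" using is_path_append(2) p(1) by blast
      then have "t \<le> length (z # vs)"
        using no_short_detour[OF g, of z z' "z # vs"] z p(3) ps by (simp add: nbrs_def)
      then show False using p(5) ps by simp
    qed
    then have "is_path F (ps @ [z])" using pF p(3) z nbrs_sym[of z F z'] by (simp add: is_path_snoc)
    moreover have "hd (ps @ [z]) = y" "last (ps @ [z]) = z" using p by (cases ps; simp)+
    ultimately show ?thesis using len by blast
  qed
  then have "card (blocked F y) \<le> card ((\<lambda>k. 2 * k + 5) ` {..<r})"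
    using card_path_ends[OF _ dy] goodD(3,4)[OF g] by blast
  also have "\<dots> \<le> r" using card_image_le[of "{..<r}"] by simp
  finally show ?thesis .
qed

lemma card_le_1_cases:
  assumes "finite M" "card M \<le> 1"
  obtains "M = {}" | u where "M = {u}"
proof -
  consider "card M = 0" | "card M = 1" using assms(2) by linarith
  then show thesis using that assms(1) by cases (auto simp: card_1_singleton_iff)
qed

text \<open>At a vertex of degree at most 1 only one colour is forbidden.\<close>

lemma card_not_free:
  assumes F: "F \<subseteq> E" and dv: "card (nbrs F v) \<le> 1"
  shows "v \<in> A \<Longrightarrow> card {w \<in> B. \<not> free F v w} \<le> m" "v \<in> B \<Longrightarrow> card {w \<in> A. \<not> free F v w} \<le> m"
proof -
  consider "nbrs F v = {}" | u where "nbrs F v = {u}"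
    using card_le_1_cases[OF finite_nbrs[OF F] dv] by metis
  then have "\<exists>\<gamma>. \<forall>w. \<not> free F v w \<longrightarrow> c {v, w} = \<gamma>"
  proof cases
    case (2 u)
    then show ?thesis by (intro exI[of _ "c {v, u}"]) (simp add: free_def)
  qed (simp add: free_def)
  then obtain \<gamma> where \<gamma>: "\<And>w. \<not> free F v w \<Longrightarrow> c {v, w} = \<gamma>" by blast
  have "card {w \<in> M. \<not> free F v w} \<le> card {w \<in> M. c {v, w} = \<gamma>}" if "finite M" for M
    using that \<gamma> by (intro card_mono) auto
  then show "v \<in> A \<Longrightarrow> card {w \<in> B. \<not> free F v w} \<le> m" "v \<in> B \<Longrightarrow> card {w \<in> A. \<not> free F v w} \<le> m"
    using fin mono_A[of v \<gamma>] mono_B[of v \<gamma>] by (meson le_trans)+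
qed

end

section \<open>A maximum good subgraph with a vertex of low degree on each side\<close>

locale deficient = coloured_bipartite +
  fixes F :: "'a set set" and x y :: 'a
  assumes g: "good F" and max: "\<And>G. good G \<Longrightarrow> card G \<le> card F"
    and x: "x \<in> A" and y: "y \<in> B"
    and dx: "card (nbrs F x) \<le> 1" and dy: "card (nbrs F y) \<le> 1"
begin

text \<open>The edge at \<open>w\<close> with the colour of \<open>vw\<close> is dropped if there is
  one, and any edge otherwise. If \<open>w\<close> had no edge, adding \<open>vw\<close> would
  contradict maximality.\<close>

lemma drop_exists:
  assumes e: "{v, w} \<in> E" and dv: "card (nbrs F v) \<le> 1" and f: "free F v w"
  shows "\<exists>w'. drops F v w w'"
proof (cases "nbrs F w = {}")
  case True
  then have "w \<notin> near F v" using near_nbrs_nonempty by blast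
  moreover have "free F w v" using True by (simp add: free_def)
  ultimately have "good (insert {v, w} F) \<and> card (insert {v, w} F) = card F + 1"
    using good_insert[OF g e dv _ f] True by simp
  then show ?thesis using max by fastforce
next
  case False
  show ?thesis
  proof (cases "\<exists>w'\<in>nbrs F w. c {w, w'} = c {w, v}")
    case True
    then obtain w' where "w' \<in> nbrs F w" "c {w, w'} = c {w, v}" by blast
    then have "drops F v w w'" using goodD(5)[OF g, of w] unfolding drops_def inj_on_def by fastforce
    then show ?thesis by blast
  next
    case f: False
    then show ?thesis using False unfolding drops_def by blast
  qed
qed

text \<open>\<open>Dx w w'\<close>: \<open>x\<close> can replace the edge \<open>ww'\<close> by \<open>xw\<close>; \<open>Dy z' z\<close>: \<open>y\<close> can replace \<open>zz'\<close> by
  \<open>yz'\<close>. Excluding \<open>w = y\<close> and \<open>z' = x\<close> keeps the edges at \<open>y\<close> and at \<open>z'\<close> unaffected by a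
  rotation at \<open>x\<close>. \<open>Dy\<close> does not ask that no short cycle arises, as this depends on the preceding
  rotation at \<open>x\<close>; it is ensured by \<open>blocked\<close> in the definition of \<open>Z\<close>.\<close>

definition Dx :: "'a \<Rightarrow> 'a \<Rightarrow> bool" where
  "Dx w w' \<longleftrightarrow> w \<in> B \<and> w \<noteq> y \<and> free F x w \<and> w \<notin> near F x \<and> drops F x w w'"

definition Dy :: "'a \<Rightarrow> 'a \<Rightarrow> bool" where
  "Dy z' z \<longleftrightarrow> z' \<in> A \<and> z' \<noteq> x \<and> free F y z' \<and> drops F y z' z"

text \<open>Vertices to which \<open>w'\<close> can be joined after losing its edge to
  \<open>w\<close>, the edge dropped in exchange at \<open>z\<close> being left open. As
  \<open>z \<noteq> w\<close>, the rotation leaves the neighbours of \<open>z\<close>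
  unchanged.\<close>

definition Z :: "'a \<Rightarrow> 'a \<Rightarrow> 'a set" where
  "Z w' w = (let R = rot F x w w' in
     {z \<in> B. z \<noteq> w \<and> free R w' z \<and> z \<notin> near R w' \<and> z \<notin> blocked R y})"

definition ZZ :: "'a \<Rightarrow> 'a set" where
  "ZZ w' = (\<Union>w\<in>{w \<in> B. Dx w w'}. Z w' w)"

definition h :: "'a \<Rightarrow> nat" where
  "h w' = card {w \<in> B. Dx w w'}"

text \<open>For \<open>z\<close> in \<open>B\<close>, its cardinality is the number \<open>i\<close>
  of the opening comment.\<close>

definition kept :: "'a \<Rightarrow> 'a set" where
  "kept z = {z' \<in> A. z' \<in> nbrs F z \<and> \<not> Dy z' z}"

definition S :: "'a set" where
  "S = {w' \<in> A. h w' > 0}"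

lemma Dx_props:
  assumes "Dx w w'"
  shows "w' \<in> A" "w' \<in> nbrs F w" "w \<in> nbrs F w'" "{x, w} \<in> E"
    "good (rot F x w w')" "card (rot F x w w') = card F"
    "nbrs (rot F x w w') y = nbrs F y" "nbrs (rot F x w w') w' = nbrs F w' - {w}"
    "card (nbrs (rot F x w w') w') \<le> 1" "x \<noteq> w'"
proof -
  have w: "w \<in> B" "w \<noteq> y" "free F x w" "w \<notin> near F x" "drops F x w w'"
    using assms by (auto simp: Dx_def)
  show e: "{x, w} \<in> E" using x w by (simp add: E_iff)
  show w': "w' \<in> nbrs F w" using w by (simp add: drops_def)
  then show w'2: "w \<in> nbrs F w'" by (simp add: nbrs_sym)
  show w'A: "w' \<in> A" using w' w nbrs_side(2)[OF goodD(1)[OF g]] by blast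
  show "good (rot F x w w')" "card (rot F x w w') = card F"
    using good_rot[OF g e dx w(3,5,4)] by auto
  note nr = nbrs_rot[OF g e w(3,5)]
  show "x \<noteq> w'" by (rule nr(5))
  show "nbrs (rot F x w w') y = nbrs F y" by (rule nr(4)) (use w(2) y x w'A disj in auto)
  show n': "nbrs (rot F x w w') w' = nbrs F w' - {w}" by (rule nr(3))
  show "card (nbrs (rot F x w w') w') \<le> 1" using n' w'2 goodD(3,4)[OF g, of w'] by simp
qed

text \<open>If \<open>y\<close> can replace \<open>zz'\<close>, the colour of \<open>w'z\<close>
  occurs on another edge of \<open>F\<close> at \<open>z\<close>; otherwise a double exchange in the
  rotated graph would enlarge \<open>F\<close>. Hence an edge at \<open>z\<close> with this colour
  is itself kept. If \<open>y\<close> can replace no edge at \<open>z\<close> and there is at most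
  one, the colour must occur too, since otherwise \<open>w'z\<close> could simply be added.\<close>

lemma Z_kept:
  assumes D: "Dx w w'" and z: "z \<in> Z w' w"
  shows "2 \<le> card (kept z) \<or> (\<exists>u. kept z = {u} \<and> c {z, w'} = c {z, u})"
proof -
  let ?R = "rot F x w w'"
  note P = Dx_props[OF D]
  have zB: "z \<in> B" and zw: "z \<noteq> w" and fz: "free ?R w' z" and nz: "z \<notin> near ?R w'"
    and bz: "z \<notin> blocked ?R y" using z by (auto simp: Z_def Let_def)
  have wB: "w \<in> B" "free F x w" "drops F x w w'" using D by (auto simp: Dx_def)
  note nr = nbrs_rot[OF g P(4) wB(2,3)]
  have nRz: "nbrs ?R z = nbrs F z" by (rule nr(4)) (use zB zw x P(1) disj in auto)
  have e: "{w', z} \<in> E" using P(1) zB by (simp add: E_iff)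
  have a: "\<exists>u\<in>nbrs F z - {z'}. c {z, u} = c {z, w'}" if Dz: "Dy z' z" for z'
  proof (rule ccontr)
    assume no: "\<not> ?thesis"
    have z': "z' \<in> A" "z' \<noteq> x" "free F y z'" "drops F y z' z" using Dz by (auto simp: Dy_def)
    have zz': "z \<in> nbrs F z'" "z' \<in> nbrs F z" using z'(4) nbrs_sym[of z F z'] by (auto simp: drops_def)
    \<comment> \<open>The edge \<open>zw'\<close> would survive the rotation because
      \<open>z \<noteq> w\<close>, contradicting \<open>fz\<close>.\<close>
    have "z' \<noteq> w'" using zz' zw free_not_nbr[OF fz] P(8) by auto
    then have nRz': "nbrs ?R z' = nbrs F z'" by (intro nr(4)) (use z' wB disj in auto)
    have "drops ?R w' z z'" using no zz' unfolding drops_def nRz by blast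
    moreover have "free ?R y z'" using z'(3) P(7) by (simp add: free_def)
    moreover have "drops ?R y z' z" using z'(4) unfolding drops_def nRz' .
    moreover have "z' \<notin> near (?R - {{z, z'}}) y" using bz zB zz' nRz by (auto simp: blocked_def)
    ultimately obtain G where "good G" "card G = card ?R + 1"
      using double_exchange[OF P(5) P(1) y zB P(9) _ fz _ nz] dy P(7) by auto
    then show False using max[of G] P(6) by simp
  qed
  have b: "\<exists>u\<in>nbrs F z. c {z, u} = c {z, w'}" if "card (nbrs F z) \<le> 1"
  proof (rule ccontr)
    assume no: "\<not> ?thesis"
    then have "free ?R z w'" using nRz by (auto simp: free_def)
    then have "good (insert {w', z} ?R) \<and> card (insert {w', z} ?R) = card ?R + 1"
      using good_insert[OF P(5) e P(9) _ fz _ nz] that nRz by simp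
    then show False using max P(6) by fastforce
  qed
  have fk: "finite (kept z)" unfolding kept_def using fin by simp
  have ke: "kept z = {u \<in> nbrs F z. \<not> Dy u z}"
    unfolding kept_def using nbrs_side(2)[OF goodD(1)[OF g] zB] by blast
  show ?thesis
  proof (cases "2 \<le> card (kept z)")
    case False
    then have k1: "card (kept z) \<le> 1" by simp
    have "\<exists>u\<in>kept z. c {z, u} = c {z, w'}"
    proof (cases "\<exists>z'. Dy z' z")
      case True
      then obtain z' u where "Dy z' z" "u \<in> nbrs F z" "c {z, u} = c {z, w'}" using a by blast
      \<comment> \<open>Otherwise \<open>a\<close> yields a second edge at \<open>z\<close> with the
        colour of \<open>w'z\<close>, so \<open>F\<close> would not be properly coloured.\<close>
      moreover have "\<not> Dy u z"
      proof
        assume "Dy u z"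
        then obtain u' where "u' \<in> nbrs F z" "u' \<noteq> u" "c {z, u'} = c {z, w'}" using a by blast
        then show False using calculation goodD(5)[OF g, of z] by (auto simp: inj_on_def)
      qed
      ultimately show ?thesis using ke by blast
    next
      case False
      then have "kept z = nbrs F z" using ke by blast
      then show ?thesis using b k1 by simp
    qed
    then show ?thesis using card_le_1_cases[OF fk k1] by (metis empty_iff singletonD)
  qed simp
qed

section \<open>Bounds for the double counting\<close>

definition excl :: "'a \<Rightarrow> 'a \<Rightarrow> 'a set" where
  "excl w' w = (let R = rot F x w w' in {w} \<union> (near R w' \<inter> B) \<union> blocked R y)"

text \<open>\<open>excl\<close> collects the exclusions from \<open>Z\<close> for reasons other than
  colour: \<open>w\<close> itself, and at most \<open>r\<close> vertices each for
  \<open>near\<close> and \<open>blocked\<close>.\<close>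

lemma card_excl:
  assumes D: "Dx w w'"
  shows "finite (excl w' w)" "card (excl w' w) \<le> 2 * r + 1"
proof -
  let ?R = "rot F x w w'"
  note P = Dx_props[OF D]
  have "finite (blocked ?R y)" using fin by (simp add: blocked_def)
  then show "finite (excl w' w)" using fin by (simp add: excl_def Let_def)
  have "card (near ?R w' \<inter> B) \<le> r" using card_near P by blast
  moreover have "card (blocked ?R y) \<le> r" using card_blocked[OF P(5) y] P(7) dy by simp
  moreover have "card (excl w' w) \<le> card {w} + card (near ?R w' \<inter> B) + card (blocked ?R y)"
    unfolding excl_def Let_def by (meson add_le_mono1 card_Un_le le_trans)
  ultimately show "card (excl w' w) \<le> 2 * r + 1" by simp
qed

lemma not_in_Z: "z \<in> B \<Longrightarrow> z \<notin> Z w' w \<Longrightarrow> z \<notin> excl w' w \<Longrightarrow> \<not> free (rot F x w w') w' z"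
  by (auto simp: Z_def excl_def Let_def)

lemma ZZ_sub: "ZZ w' \<subseteq> B"
  by (auto simp: ZZ_def Z_def Let_def)

lemma card_B_minus: "M \<subseteq> B \<Longrightarrow> card M + card (B - M) = n"
  using fin card_B card_mono[of B M] by (simp add: card_Diff_subset finite_subset)

text \<open>Outside \<open>excl\<close>, a vertex is lost only through the colour of an edge left at
  \<open>w'\<close>, which happens at most \<open>m\<close> times.\<close>

lemma card_ZZ1:
  assumes D: "Dx w w'"
  shows "n \<le> card (ZZ w') + m + 2 * r + 1"
proof -
  let ?R = "rot F x w w'"
  note P = Dx_props[OF D]
  have wB: "w \<in> B" using D by (simp add: Dx_def)
  have "B - ZZ w' \<subseteq> excl w' w \<union> {z \<in> B. \<not> free ?R w' z}"
    using not_in_Z D wB by (auto simp: ZZ_def)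
  then have "card (B - ZZ w') \<le> card (excl w' w \<union> {z \<in> B. \<not> free ?R w' z})"
    using fin card_excl(1)[OF D] by (intro card_mono) auto
  also have "\<dots> \<le> (2 * r + 1) + m"
    using card_Un_le[of "excl w' w" "{z \<in> B. \<not> free ?R w' z}"] card_excl(2)[OF D]
      card_not_free(1)[OF goodD(1)[OF P(5)] P(9) P(1)] by linarith
  finally show ?thesis using card_B_minus[OF ZZ_sub, of w'] by linarith
qed

text \<open>Each of the two rotations leaves the other edge at \<open>w'\<close>. A vertex lost by
  colour in both would need \<open>w'z\<close> to have the colours of both edges at
  \<open>w'\<close>, which differ; so only the two sets \<open>excl\<close> are lost.\<close>

lemma card_ZZ2:
  assumes D1: "Dx w1 w'" and D2: "Dx w2 w'" and ne: "w1 \<noteq> w2"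
  shows "n \<le> card (ZZ w') + 4 * r + 2"
proof -
  note P1 = Dx_props[OF D1] and P2 = Dx_props[OF D2]
  have wB: "w1 \<in> B" "w2 \<in> B" using D1 D2 by (auto simp: Dx_def)
  have nb: "nbrs F w' = {w1, w2}"
    using card_seteq[of "nbrs F w'" "{w1, w2}"] P1(3) P2(3) ne goodD(3,4)[OF g, of w'] by simp
  have "B - ZZ w' \<subseteq> excl w' w1 \<union> excl w' w2"
  proof (rule subsetI, rule ccontr)
    fix z assume z: "z \<in> B - ZZ w'" "z \<notin> excl w' w1 \<union> excl w' w2"
    then have "z \<notin> Z w' w1" "z \<notin> Z w' w2" using D1 D2 wB by (auto simp: ZZ_def)
    then have "\<not> free (rot F x w1 w') w' z" "\<not> free (rot F x w2 w') w' z"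
      using not_in_Z z by auto
    then have "c {w', w2} = c {w', z}" "c {w', w1} = c {w', z}"
      unfolding free_def P1(8) P2(8) nb using ne by auto
    then show False using goodD(5)[OF g, of w'] nb ne by (auto simp: inj_on_def)
  qed
  then have "card (B - ZZ w') \<le> card (excl w' w1 \<union> excl w' w2)"
    using card_excl(1)[OF D1] card_excl(1)[OF D2] by (intro card_mono) auto
  also have "\<dots> \<le> (2 * r + 1) + (2 * r + 1)"
    using card_Un_le[of "excl w' w1" "excl w' w2"] card_excl(2)[OF D1] card_excl(2)[OF D2] by linarith
  finally show ?thesis using card_B_minus[OF ZZ_sub, of w'] by linarith
qed

lemma h_le: "h w' \<le> 2"
proof -
  have "{w \<in> B. Dx w w'} \<subseteq> nbrs F w'" using Dx_props(3) by blast
  then show ?thesis unfolding h_def using goodD(3,4)[OF g, of w'] card_mono le_trans by blast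
qed

lemma card_ZZ:
  assumes "w' \<in> S"
  shows "n \<le> card (ZZ w') + m + 2 * r + 1"
    and "h w' = 2 \<Longrightarrow> n \<le> card (ZZ w') + 4 * r + 2"
proof -
  have "{w \<in> B. Dx w w'} \<noteq> {}" using assms by (auto simp: S_def h_def card_gt_0_iff)
  then show "n \<le> card (ZZ w') + m + 2 * r + 1" using card_ZZ1 by blast
  assume "h w' = 2"
  then obtain w1 w2 where "w1 \<noteq> w2" "{w \<in> B. Dx w w'} = {w1, w2}"
    unfolding h_def by (auto simp: card_2_iff)
  then show "n \<le> card (ZZ w') + 4 * r + 2" using card_ZZ2 by blast
qed

text \<open>The pairs are counted at \<open>w\<close>: except for \<open>y\<close>, at most
  \<open>m\<close> vertices forbidden by colour and at most \<open>r\<close> near ones, every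
  \<open>w\<close> admits a rotation by \<open>drop_exists\<close>.\<close>

lemma sum_h: "n \<le> (\<Sum>w'\<in>A. h w') + m + r + 1"
proof -
  let ?N = "{w \<in> B. w \<noteq> y \<and> free F x w \<and> w \<notin> near F x}"
  have "B - ?N \<subseteq> {y} \<union> {w \<in> B. \<not> free F x w} \<union> (near F x \<inter> B)" by auto
  then have "card (B - ?N) \<le> card ({y} \<union> {w \<in> B. \<not> free F x w} \<union> (near F x \<inter> B))"
    using fin by (intro card_mono) auto
  also have "\<dots> \<le> card {y} + card {w \<in> B. \<not> free F x w} + card (near F x \<inter> B)"
    by (meson add_le_mono1 card_Un_le le_trans)
  also have "\<dots> \<le> 1 + m + r"
    using card_not_free(1)[OF goodD(1)[OF g] dx x] card_near[OF g x dx] by simp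
  finally have N: "n \<le> card ?N + m + r + 1" using card_B_minus[of ?N] by auto
  have "card ?N = (\<Sum>w\<in>B. of_bool (w \<in> ?N))" using fin by (simp add: Int_def)
  also have "\<dots> \<le> (\<Sum>w\<in>B. card {w' \<in> A. Dx w w'})"
  proof (rule sum_mono)
    fix w assume "w \<in> B"
    show "of_bool (w \<in> ?N) \<le> card {w' \<in> A. Dx w w'}"
    proof (cases "w \<in> ?N")
      case True
      then have "\<exists>w'. drops F x w w'" using drop_exists[of x w] dx x by (auto simp: E_iff)
      then obtain w' where "Dx w w'" using True by (auto simp: Dx_def)
      then have "w' \<in> {w' \<in> A. Dx w w'}" using Dx_props(1) by blast
      then have "card {w' \<in> A. Dx w w'} \<noteq> 0" using fin by auto
      then show ?thesis by (simp add: Suc_le_eq)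
    qed (simp del: mem_Collect_eq)
  qed
  also have "\<dots> = (\<Sum>w'\<in>A. h w')" unfolding h_def by (rule sum_card_swap[OF fin(2,1)])
  finally show ?thesis using N by linarith
qed

text \<open>Counted at \<open>z'\<close>, at least \<open>n - m - 1\<close> edges can be replaced by
  \<open>y\<close>. As \<open>F\<close> has at most \<open>2 * n\<close> edges, the bound for the
  kept ones follows.\<close>

lemma sum_kept: "(\<Sum>z\<in>B. card (kept z)) \<le> n + m + 1"
proof -
  let ?N = "{z' \<in> A. z' \<noteq> x \<and> free F y z'}"
  have "A \<subseteq> ?N \<union> ({x} \<union> {w \<in> A. \<not> free F y w})" by auto
  then have "card A \<le> card (?N \<union> ({x} \<union> {w \<in> A. \<not> free F y w}))"
    using fin by (intro card_mono) auto
  also have "\<dots> \<le> card ?N + (card {x} + card {w \<in> A. \<not> free F y w})"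
    by (meson add_left_mono card_Un_le le_trans)
  also have "\<dots> \<le> card ?N + (1 + m)"
    using card_not_free(2)[OF goodD(1)[OF g] dy y] by simp
  finally have N: "n \<le> card ?N + m + 1" using card_A by simp
  have "card ?N = (\<Sum>z'\<in>A. of_bool (z' \<in> ?N))" using fin by (simp add: Int_def)
  also have "\<dots> \<le> (\<Sum>z'\<in>A. card {z \<in> B. Dy z' z})"
  proof (rule sum_mono)
    fix z' assume "z' \<in> A"
    show "of_bool (z' \<in> ?N) \<le> card {z \<in> B. Dy z' z}"
    proof (cases "z' \<in> ?N")
      case True
      then have "\<exists>z. drops F y z' z" using drop_exists[of y z'] dy y by (auto simp: E_iff)
      then obtain z where z: "Dy z' z" using True by (auto simp: Dy_def)
      then have "z \<in> B" using nbrs_side(1)[OF goodD(1)[OF g]] by (auto simp: Dy_def drops_def)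
      then have "card {z \<in> B. Dy z' z} \<noteq> 0" using fin z by auto
      then show ?thesis by (simp add: Suc_le_eq)
    qed (simp del: mem_Collect_eq)
  qed
  also have "\<dots> = (\<Sum>z\<in>B. card {z' \<in> A. Dy z' z})" by (rule sum_card_swap[OF fin])
  finally have D: "card ?N \<le> (\<Sum>z\<in>B. card {z' \<in> A. Dy z' z})" .
  have "(\<Sum>z\<in>B. card (kept z) + card {z' \<in> A. Dy z' z}) \<le> (\<Sum>z\<in>B. 2)"
  proof (rule sum_mono)
    fix z assume "z \<in> B"
    have "kept z \<union> {z' \<in> A. Dy z' z} \<subseteq> nbrs F z"
      by (auto simp: kept_def Dy_def drops_def nbrs_sym[of z])
    then have "card (kept z \<union> {z' \<in> A. Dy z' z}) \<le> 2"
      using goodD(3,4)[OF g, of z] card_mono le_trans by blast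
    moreover have "card (kept z \<union> {z' \<in> A. Dy z' z}) = card (kept z) + card {z' \<in> A. Dy z' z}"
      using fin by (intro card_Un_disjoint) (auto simp: kept_def)
    ultimately show "card (kept z) + card {z' \<in> A. Dy z' z} \<le> 2" by simp
  qed
  then have "(\<Sum>z\<in>B. card (kept z)) + (\<Sum>z\<in>B. card {z' \<in> A. Dy z' z}) \<le> 2 * n"
    using card_B by (simp add: sum.distrib)
  then show ?thesis using N D by linarith
qed

lemma card_kept_le: "card (kept z) \<le> 2"
proof -
  have "kept z \<subseteq> nbrs F z" by (auto simp: kept_def)
  then show ?thesis using goodD(3,4)[OF g, of z] card_mono le_trans by blast
qed

text \<open>By \<open>Z_kept\<close>, an empty \<open>kept z\<close> admits no \<open>w'\<close>; if
  \<open>kept z\<close> is \<open>{u}\<close>, all \<open>w'\<close> counted are joined to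
  \<open>z\<close> in the colour of \<open>zu\<close>.\<close>

lemma card_hits:
  assumes zB: "z \<in> B"
  defines "q \<equiv> card {w' \<in> S. z \<in> ZZ w'}"
  shows "card (kept z) = 0 \<Longrightarrow> q = 0" "card (kept z) = 1 \<Longrightarrow> q \<le> m" "q \<le> card S"
proof -
  have fS: "finite S" using fin by (simp add: S_def)
  then show "q \<le> card S" unfolding q_def by (intro card_mono) auto
  have k: "2 \<le> card (kept z) \<or> (\<exists>u. kept z = {u} \<and> c {z, w'} = c {z, u})" if "z \<in> ZZ w'" for w'
    using that Z_kept by (auto simp: ZZ_def)
  show "q = 0" if "card (kept z) = 0"
  proof -
    have "{w' \<in> S. z \<in> ZZ w'} = {}" using k that by fastforce
    then show ?thesis by (simp only: q_def card.empty)
  qed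
  show "q \<le> m" if "card (kept z) = 1"
  proof -
    obtain u where u: "kept z = {u}" using \<open>card (kept z) = 1\<close> card_1_singletonE by blast
    have "{w' \<in> S. z \<in> ZZ w'} \<subseteq> {w' \<in> A. c {z, w'} = c {z, u}}"
      using k u by (fastforce simp: S_def)
    then have "q \<le> card {w' \<in> A. c {z, w'} = c {z, u}}"
      unfolding q_def using fin by (intro card_mono) auto
    then show ?thesis using mono_B[OF zB] le_trans by blast
  qed
qed

lemma contradiction: False
proof -
  define p where "p = card S"
  define T where "T = (\<Sum>w'\<in>S. card (ZZ w'))"
  define K where "K = (\<Sum>z\<in>B. card (kept z))"
  define H where "H = (\<Sum>w'\<in>A. h w')"
  have fS: "finite S" "S \<subseteq> A" using fin by (auto simp: S_def)
  have HS: "H = (\<Sum>w'\<in>S. h w')"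
    unfolding H_def using fin fS by (intro sum.mono_neutral_right) (auto simp: S_def)
  have Hp: "H \<le> 2 * p" unfolding HS p_def using sum_mono[of S h "\<lambda>_. 2"] h_le by simp
  have Tq: "T = (\<Sum>z\<in>B. card {w' \<in> S. z \<in> ZZ w'})"
  proof -
    have "T = (\<Sum>w'\<in>S. card {z \<in> B. z \<in> ZZ w'})"
      unfolding T_def using ZZ_sub by (intro sum.cong) (auto intro!: arg_cong[where f = card])
    then show ?thesis using sum_card_swap[OF fS(1) fin(2), of "\<lambda>w' z. z \<in> ZZ w'"] by simp
  qed
  have T1: "int p * (int n - m - 2 * r - 1) \<le> T"
  proof -
    have "(\<Sum>w'\<in>S. int n - m - 2 * r - 1) \<le> (\<Sum>w'\<in>S. int (card (ZZ w')))"
      using card_ZZ(1) by (intro sum_mono) fastforce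
    then show ?thesis by (simp add: T_def p_def)
  qed
  \<comment> \<open>On \<open>S\<close> the factor \<open>h w' - 1\<close> is 1 if both edges at
    \<open>w'\<close> can be the one replaced and 0 otherwise; the bound of \<open>card_ZZ2\<close>
    exceeds that of \<open>card_ZZ1\<close> by \<open>m - 2 * r - 1\<close>.\<close>
  have T2: "int p * (int n - m - 2 * r - 1) + (int H - p) * (int m - 2 * r - 1) \<le> T"
    if "2 * int r + 1 \<le> m"
  proof -
    have "(\<Sum>w'\<in>S. (int n - m - 2 * r - 1) + (int (h w') - 1) * (int m - 2 * r - 1))
        \<le> (\<Sum>w'\<in>S. int (card (ZZ w')))"
    proof (rule sum_mono)
      fix w' assume w': "w' \<in> S"
      then have "h w' = 1 \<or> h w' = 2" using h_le[of w'] by (auto simp: S_def)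
      then show "(int n - m - 2 * r - 1) + (int (h w') - 1) * (int m - 2 * r - 1) \<le> int (card (ZZ w'))"
        using card_ZZ[OF w'] by auto
    qed
    then show ?thesis
      by (simp add: T_def p_def HS sum.distrib sum_distrib_right[symmetric] sum_subtractf)
  qed
  \<comment> \<open>The bounds 0, \<open>m\<close>, \<open>p\<close> for 0, 1, 2 kept edges amount
    to at most half of \<open>p\<close> per kept edge.\<close>
  have U1: "2 * int T \<le> int p * K" if "2 * int m \<le> p"
  proof -
    have "(\<Sum>z\<in>B. 2 * card {w' \<in> S. z \<in> ZZ w'}) \<le> (\<Sum>z\<in>B. p * card (kept z))"
    proof (rule sum_mono)
      fix z assume z: "z \<in> B"
      consider "card (kept z) = 0" | "card (kept z) = 1" | "card (kept z) = 2"
        using card_kept_le[of z] by linarith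
      then show "2 * card {w' \<in> S. z \<in> ZZ w'} \<le> p * card (kept z)"
        using card_hits[OF z] that by cases (auto simp: p_def)
    qed
    then have "2 * T \<le> p * K" by (simp add: Tq K_def sum_distrib_left)
    then show ?thesis by (metis of_nat_le_iff of_nat_mult of_nat_numeral)
  qed
  \<comment> \<open>Now 0, \<open>m\<close>, \<open>p\<close> are bounded by the line with values
    \<open>m\<close> at 1 and \<open>p\<close> at 2; its value at 0 is \<open>2 * m - p\<close>,
    which is nonnegative here.\<close>
  have U2: "int T \<le> (int p - m) * K + (2 * int m - p) * n" if "int m \<le> p" "int p \<le> 2 * int m"
  proof -
    have "(\<Sum>z\<in>B. int (card {w' \<in> S. z \<in> ZZ w'})) \<le> (\<Sum>z\<in>B. (int p - m) * card (kept z) + (2 * int m - p))"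
    proof (rule sum_mono)
      fix z assume z: "z \<in> B"
      consider "card (kept z) = 0" | "card (kept z) = 1" | "card (kept z) = 2"
        using card_kept_le[of z] by linarith
      then show "int (card {w' \<in> S. z \<in> ZZ w'}) \<le> (int p - m) * card (kept z) + (2 * int m - p)"
        using card_hits[OF z] that by cases (auto simp: p_def)
    qed
    also have "\<dots> = (int p - m) * K + (2 * int m - p) * n"
      by (simp add: K_def sum.distrib sum_distrib_left card_B)
    finally show ?thesis by (simp add: Tq)
  qed
  show False
  proof (rule counting_contradiction[of "int m" "int r" "int n" "int H" "int p" "int K" "int T"])
    show "3 * int m + 6 * int r + 6 \<le> int n" using n_ge by linarith
    show "int n \<le> int H + int m + int r + 1" using sum_h unfolding H_def by linarith
    show "int K \<le> int n + int m + 1" using sum_kept unfolding K_def by linarith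
  qed (use Hp T1 T2 U1 U2 in \<open>simp_all add: algebra_simps\<close>)
qed

end

section \<open>From maximum good subgraphs to 2-factors\<close>

context coloured_bipartite
begin

lemma degree_eq_card_nbrs:
  assumes "F \<subseteq> E"
  shows "degree F v = card (nbrs F v)"
proof -
  have "incident_edges F v = (\<lambda>u. {v, u}) ` nbrs F v"
    using assms by (fastforce simp: incident_edges_def nbrs_def complete_bipartite_def insert_commute)
  moreover have "inj_on (\<lambda>u. {v, u}) (nbrs F v)" by (auto simp: inj_on_def doubleton_eq_iff)
  ultimately show ?thesis by (simp add: degree_def card_image)
qed

lemma good_properly_colored:
  assumes g: "good F"
  shows "properly_colored c F"
  unfolding properly_colored_def
proof (intro ballI impI)
  fix e f assume e: "e \<in> F" and f: "f \<in> F" and ef: "e \<noteq> f \<and> e \<inter> f \<noteq> {}"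
  then obtain v where v: "v \<in> e" "v \<in> f" by blast
  have other: "\<exists>u. d = {v, u}" if "d \<in> F" "v \<in> d" for d
    using that goodD(1)[OF g] by (fastforce simp: complete_bipartite_def)
  obtain u w where "e = {v, u}" "f = {v, w}" using other e f v by blast
  then show "c e \<noteq> c f"
    using e f ef goodD(5)[OF g, of v] by (auto simp: inj_on_def nbrs_def)
qed

lemma sum_card_nbrs:
  assumes "F \<subseteq> E"
  shows "(\<Sum>v\<in>A. card (nbrs F v)) = (\<Sum>v\<in>B. card (nbrs F v))"
proof -
  have "nbrs F v = {u \<in> B. u \<in> nbrs F v}" if "v \<in> A" for v
    using nbrs_side(1)[OF assms that] by blast
  moreover have "nbrs F v = {u \<in> A. v \<in> nbrs F u}" if "v \<in> B" for v
    using nbrs_side(2)[OF assms that] nbrs_sym[of v F] by blast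
  ultimately show ?thesis using sum_card_swap[OF fin, of "\<lambda>v u. u \<in> nbrs F v"] by simp
qed

text \<open>A largest good subgraph is taken. The degree sums over \<open>A\<close> and
  \<open>B\<close> agree, both counting the edges, so a single vertex of degree below 2 forces such
  vertices on both sides, which \<open>contradiction\<close> rules out.\<close>

lemma ex_two_factor:
  "\<exists>H. two_factor (A \<union> B) E H \<and> properly_colored c H \<and> (\<forall>vs. is_cycle H vs \<longrightarrow> t \<le> length vs)"
proof -
  have "\<not> is_cycle {} vs" for vs :: "'v list" unfolding is_cycle_def by (cases vs) auto
  then have "good {}" by (auto simp: good_def nbrs_def)
  moreover have "\<forall>G. good G \<longrightarrow> card G < card E + 1"
    using goodD(1) card_mono[OF finite_E] by (simp add: less_Suc_eq_le)
  ultimately have "\<exists>F. good F \<and> (\<forall>G. good G \<longrightarrow> card G \<le> card F)"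
    by (rule ex_has_greatest_nat)
  then obtain F where g: "good F" and max: "\<And>G. good G \<Longrightarrow> card G \<le> card F"
    by blast
  have "card (nbrs F v) = 2" if v: "v \<in> A \<union> B" for v
  proof (rule ccontr)
    assume "card (nbrs F v) \<noteq> 2"
    then have lt: "card (nbrs F v) < 2" using goodD(4)[OF g, of v] by simp
    have sums: "(\<Sum>v\<in>A. card (nbrs F v)) < 2 * n"
    proof (cases "v \<in> A")
      case True
      then have "(\<Sum>v\<in>A. card (nbrs F v)) < (\<Sum>v\<in>A. 2)"
        using lt fin goodD(4)[OF g] by (intro sum_strict_mono_ex1) auto
      then show ?thesis by (simp add: card_A)
    next
      case False
      then have "(\<Sum>v\<in>B. card (nbrs F v)) < (\<Sum>v\<in>B. 2)"
        using v lt fin goodD(4)[OF g] by (intro sum_strict_mono_ex1) auto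
      then show ?thesis by (simp add: card_B sum_card_nbrs[OF goodD(1)[OF g]])
    qed
    have "\<exists>x\<in>A. card (nbrs F x) \<le> 1"
    proof (rule ccontr)
      assume "\<not> ?thesis"
      then have "(\<Sum>v\<in>A. 2) \<le> (\<Sum>v\<in>A. card (nbrs F v))" by (intro sum_mono) force
      then show False using sums by (simp add: card_A)
    qed
    moreover have "\<exists>y\<in>B. card (nbrs F y) \<le> 1"
    proof (rule ccontr)
      assume "\<not> ?thesis"
      then have "(\<Sum>v\<in>B. 2) \<le> (\<Sum>v\<in>B. card (nbrs F v))" by (intro sum_mono) force
      then show False using sums by (simp add: card_B sum_card_nbrs[OF goodD(1)[OF g]])
    qed
    ultimately obtain x y where xy: "x \<in> A" "card (nbrs F x) \<le> 1" "y \<in> B" "card (nbrs F y) \<le> 1" by blast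
    interpret deficient A B c n m r t F x y
      using g max xy by unfold_locales auto
    show False by (rule contradiction)
  qed
  then have "two_factor (A \<union> B) E F"
    using goodD(1)[OF g] degree_eq_card_nbrs by (simp add: two_factor_def)
  then show ?thesis using good_properly_colored[OF g] goodD(6)[OF g] by blast
qed

end

section \<open>From colour degrees to monochromatic degrees\<close>

lemma complete_bipartite_commute: "complete_bipartite A B = complete_bipartite B A"
  by (intro set_eqI iffI; clarsimp simp: complete_bipartite_def; metis insert_commute)

text \<open>Each element outside the fibre contributes at most one value, and the whole fibre at
  most one more.\<close>

lemma card_fibre_le:
  assumes "finite B"
  shows "card {u \<in> B. f u = \<gamma>} + card (f ` B) \<le> card B + 1"
proof -
  have "f ` B \<subseteq> insert \<gamma> (f ` {u \<in> B. f u \<noteq> \<gamma>})" by auto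
  then have "card (f ` B) \<le> card (insert \<gamma> (f ` {u \<in> B. f u \<noteq> \<gamma>}))"
    using assms by (intro card_mono) auto
  then have "card (f ` B) \<le> card {u \<in> B. f u \<noteq> \<gamma>} + 1"
    using assms card_image_le[of "{u \<in> B. f u \<noteq> \<gamma>}" f] by (simp add: card_insert_if split: if_splits)
  moreover have "card {u \<in> B. f u \<noteq> \<gamma>} + card {u \<in> B. f u = \<gamma>} = card B"
    using assms by (subst card_Un_disjoint[symmetric]) (auto intro!: arg_cong[where f = card])
  ultimately show ?thesis by linarith
qed

lemma color_degree_complete_bipartite:
  assumes "v \<in> A" "A \<inter> B = {}"
  shows "color_degree c (complete_bipartite A B) v = card ((\<lambda>u. c {v, u}) ` B)"
proof -
  have "incident_edges (complete_bipartite A B) v = (\<lambda>u. {v, u}) ` B"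
    using assms by (auto simp: incident_edges_def complete_bipartite_def)
  then show ?thesis by (simp add: color_degree_def image_image)
qed

theorem theorem1p4:
  fixes A B :: "'v set" and c :: "'v set \<Rightarrow> 'c" and n t :: nat
  assumes "t \<ge> 3" and "n \<ge> 1"
    and "finite A" and "finite B" and "A \<inter> B = {}"
    and "card A = n" and "card B = n"
    and "real (min_color_degree c (A \<union> B) (complete_bipartite A B)) \<ge> 2 * real n / 3 + real t"
  shows "\<exists>H. two_factor (A \<union> B) (complete_bipartite A B) H \<and> properly_colored c H \<and>
           (\<forall>vs. is_cycle H vs \<longrightarrow> length vs \<ge> t)"
proof -
  define \<delta> where "\<delta> = min_color_degree c (A \<union> B) (complete_bipartite A B)"
  have \<delta>_le: "\<delta> \<le> color_degree c (complete_bipartite A B) v" if "v \<in> A \<union> B" for v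
    using that assms(3,4) by (simp add: \<delta>_def min_color_degree_def)
  have \<delta>A: "\<delta> \<le> card ((\<lambda>u. c {v, u}) ` B)" if "v \<in> A" for v
    using \<delta>_le[of v] that color_degree_complete_bipartite[OF that assms(5), of c] by simp
  have \<delta>B: "\<delta> \<le> card ((\<lambda>u. c {v, u}) ` A)" if "v \<in> B" for v
    using \<delta>_le[of v] that color_degree_complete_bipartite[of v B A c] assms(5)
    by (simp add: complete_bipartite_commute[of A B] Int_commute)
  have big: "2 * n + 3 * t \<le> 3 * \<delta>"
    using assms(8) unfolding \<delta>_def[symmetric] by linarith
  \<comment> \<open>\<open>n\<close> is positive, so some vertex exists and gives
    \<open>\<delta> \<le> n\<close>; this makes the natural subtraction in \<open>m\<close>
    exact.\<close>
  obtain a where "a \<in> A" using assms(2,6) by fastforce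
  then have "\<delta> \<le> n" using \<delta>A card_image_le[OF assms(4)] assms(7) le_trans by blast
  \<comment> \<open>This is the bound on monochromatic degrees given by
    \<open>card_fibre_le\<close>.\<close>
  define m where "m = n + 1 - \<delta>"
  \<comment> \<open>The number of even integers at least 4 and below \<open>t\<close>.\<close>
  define r where "r = (t - 3) div 2"
  interpret coloured_bipartite A B c n m r t
  proof
    show "card {u \<in> B. c {v, u} = \<gamma>} \<le> m" if "v \<in> A" for v \<gamma>
      using card_fibre_le[OF assms(4), of "\<lambda>u. c {v, u}" \<gamma>] \<delta>A[OF that] assms(7)
      unfolding m_def by linarith
    show "card {u \<in> A. c {v, u} = \<gamma>} \<le> m" if "v \<in> B" for v \<gamma>
      using card_fibre_le[OF assms(3), of "\<lambda>u. c {v, u}" \<gamma>] \<delta>B[OF that] assms(6)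
      unfolding m_def by linarith
    \<comment> \<open>The bound \<open>n_ge\<close> adds up
      \<open>3 * m \<le> n + 3 - 3 * t\<close>, from \<open>big\<close>, and
      \<open>6 * r \<le> 3 * t - 9\<close>.\<close>
    have "2 * r \<le> t - 3" "t \<le> 2 * r + 4" unfolding r_def using assms(1) by linarith+
    then show "3 * m + 6 * r + 6 \<le> n" "t \<le> 2 * r + 4"
      using big \<open>\<delta> \<le> n\<close> assms(1) unfolding m_def by linarith+
  qed (use assms in auto)
  show ?thesis by (rule ex_two_factor)
qed

end
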